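(* Let $G$ be a finite, simple, connected graph and let $H$ be a finite, simple, connected graph with at least two vertices. Then $\zeta(G \square H) \leq \zeta(G) + \psi(H) - 1$.
   Context: The localization game on a connected graph $G$ is played by a Cop controlling $k$ cops and a Robber. The Robber first chooses a vertex $r$, unknown to the Cop. In each turn the Cop probes a set $B=\{b_1,\dots,b_k\}$ of $k$ vertices (repetitions across turns allowed) and receives the distance vector $[d_G(r,b_1),\dots,d_G(r,b_k)]$. If the Cop can determine $r$ exactly, the Cop wins; otherwise the Robber may stay at $r$ or move to a neighbour of $r$, and the next turn begins. The Cop wins if the Robber is located after finitely many turns. The localization number $\zeta(G)$ is the least positive integer $k$ such that the Cop has a winning strategy with $k$ cops against every Robber strategy. $G \square H$ is the Cartesian product: vertex set $V(G)\times V(H)$, $(u,u')\sim(v,v')$ iff either $u=v$ and $u'v'\in E(H)$, or $u'=v'$ and $uv\in E(G)$. For a graph $H$ with at least two vertices, two vertices $v_1,v_2$ are doubly resolved by vertices $u_1,u_2$ if $d(v_1,u_1)-d(v_2,u_1)\neq d(v_1,u_2)-d(v_2,u_2)$; a set $W\subseteq V(H)$ is a doubly resolving set if every pair of distinct vertices of $H$ is doubly resolved by two vertices of $W$; $\psi(H)$ is the minimum cardinality of a doubly resolving set of $H$. *)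

theory Defs
  imports "Graph_Theory.Graph_Theory"
begin

text \<open>
  A finite simple graph is a \<^locale>\<open>pair_graph\<close>: finite vertex set, and a symmetric irreflexive
  set of ordered pairs as edge relation. The library's \<^const>\<open>connected\<close> includes that the
  vertex set is nonempty.
\<close>

definition gdist :: "'a pair_pre_digraph \<Rightarrow> 'a \<Rightarrow> 'a \<Rightarrow> nat" where
  "gdist G u v = (LEAST n. \<exists>p. pre_digraph.awalk (with_proj G) u p v \<and> length p = n)"

definition cartesian_product ::
  "'a pair_pre_digraph \<Rightarrow> 'b pair_pre_digraph \<Rightarrow> ('a \<times> 'b) pair_pre_digraph"  (infixl \<open>\<box>\<close> 70) where
  "G \<box> H = \<lparr> pverts = pverts G \<times> pverts H,
     parcs = {((u, u'), (v, v')) | u u' v v'.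
        (u = v \<and> u \<in> pverts G \<and> (u', v') \<in> parcs H) \<or>
        (u' = v' \<and> u' \<in> pverts H \<and> (u, v) \<in> parcs G)} \<rparr>"


subsection \<open>The localization game\<close>

text \<open>
  A strategy of the Cop maps the list of distance vectors received in the previous turns to the
  next probe. The \<open>k\<close> probed vertices of one turn form a set; they are listed in some order
  so that the answer is a vector.
\<close>

definition cop_strategy :: "'a pair_pre_digraph \<Rightarrow> nat \<Rightarrow> (nat list list \<Rightarrow> 'a list) \<Rightarrow> bool" where
  "cop_strategy G k \<sigma> \<longleftrightarrow>
     (\<forall>h. length (\<sigma> h) = k \<and> distinct (\<sigma> h) \<and> set (\<sigma> h) \<subseteq> pverts G)"

text \<open>
  \<open>r t\<close> is the position of the Robber when the probe of turn \<open>t\<close> (counted from \<open>0\<close>) is made.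
  Against a fixed strategy of the Cop, the plays resulting from the (possibly adaptive) strategies
  of the Robber are exactly those along such sequences.
\<close>

definition robber_walk :: "'a pair_pre_digraph \<Rightarrow> (nat \<Rightarrow> 'a) \<Rightarrow> bool" where
  "robber_walk G r \<longleftrightarrow>
     r 0 \<in> pverts G \<and> (\<forall>t. r (Suc t) = r t \<or> (r t, r (Suc t)) \<in> parcs G)"

text \<open>The distance vectors received in the first \<open>t\<close> turns:\<close>

primrec answers ::
  "'a pair_pre_digraph \<Rightarrow> (nat list list \<Rightarrow> 'a list) \<Rightarrow> (nat \<Rightarrow> 'a) \<Rightarrow> nat \<Rightarrow> nat list list" where
  "answers G \<sigma> r 0 = []"
| "answers G \<sigma> r (Suc t) =
     answers G \<sigma> r t @ [map (\<lambda>b. gdist G (r t) b) (\<sigma> (answers G \<sigma> r t))]"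

text \<open>
  After the probe of turn \<open>t\<close> the Cop can determine the position of the Robber exactly: all
  Robber walks compatible with everything the Cop has been told agree on it.
\<close>

definition located ::
  "'a pair_pre_digraph \<Rightarrow> (nat list list \<Rightarrow> 'a list) \<Rightarrow> (nat \<Rightarrow> 'a) \<Rightarrow> nat \<Rightarrow> bool" where
  "located G \<sigma> r t \<longleftrightarrow>
     (\<forall>r'. robber_walk G r' \<and> answers G \<sigma> r' (Suc t) = answers G \<sigma> r (Suc t) \<longrightarrow> r' t = r t)"

definition winning_strategy :: "'a pair_pre_digraph \<Rightarrow> nat \<Rightarrow> (nat list list \<Rightarrow> 'a list) \<Rightarrow> bool" where
  "winning_strategy G k \<sigma> \<longleftrightarrow>
     cop_strategy G k \<sigma> \<and> (\<forall>r. robber_walk G r \<longrightarrow> (\<exists>t. located G \<sigma> r t))"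

definition localization_number :: "'a pair_pre_digraph \<Rightarrow> nat"  (\<open>\<zeta>\<close>) where
  "\<zeta> G = (LEAST k. 0 < k \<and> (\<exists>\<sigma>. winning_strategy G k \<sigma>))"


subsection \<open>Doubly resolving sets\<close>

definition doubly_resolved :: "'a pair_pre_digraph \<Rightarrow> 'a \<Rightarrow> 'a \<Rightarrow> 'a \<Rightarrow> 'a \<Rightarrow> bool" where
  "doubly_resolved H v1 v2 u1 u2 \<longleftrightarrow>
     int (gdist H v1 u1) - int (gdist H v2 u1) \<noteq> int (gdist H v1 u2) - int (gdist H v2 u2)"

definition doubly_resolving_set :: "'a pair_pre_digraph \<Rightarrow> 'a set \<Rightarrow> bool" where
  "doubly_resolving_set H W \<longleftrightarrow> W \<subseteq> pverts H \<and>
     (\<forall>v1 \<in> pverts H. \<forall>v2 \<in> pverts H. v1 \<noteq> v2 \<longrightarrow>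
        (\<exists>u1 \<in> W. \<exists>u2 \<in> W. doubly_resolved H v1 v2 u1 u2))"

definition min_doubly_resolving :: "'a pair_pre_digraph \<Rightarrow> nat"  (\<open>\<psi>\<close>) where
  "\<psi> H = (LEAST n. \<exists>W. doubly_resolving_set H W \<and> card W = n)"


subsection \<open>The invariants are well defined\<close>

lemma gdist_self: "u \<in> pverts G \<Longrightarrow> gdist G u u = 0"
  unfolding gdist_def
  by (rule Least_eq_0) (auto simp: pre_digraph.awalk_def pre_digraph.cas.simps intro!: exI[of _ "[]"])

lemma gdist_eq_0_iff:
  assumes "pair_graph G" "connected (with_proj G)" "u \<in> pverts G" "v \<in> pverts G"
  shows "gdist G u v = 0 \<longleftrightarrow> u = v"
proof
  interpret pair_graph G by fact
  have "strongly_connected (with_proj G)"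
    using assms(2) symmetric_connected_imp_strongly_connected[OF sym_arcs] by simp
  then have "u \<rightarrow>\<^sup>*\<^bsub>with_proj G\<^esub> v"
    using assms(3,4) by (simp add: strongly_connected_def)
  then have "\<exists>p. awalk u p v"
    by (simp add: reachable_awalk)
  then have "\<exists>n p. awalk u p v \<and> length p = n"
    by blast
  then have "\<exists>p. awalk u p v \<and> length p = gdist G u v"
    unfolding gdist_def by (rule LeastI_ex)
  moreover assume "gdist G u v = 0"
  ultimately show "u = v"
    by (auto simp: awalk_def)
qed (use assms(3) gdist_self in auto)

lemma pair_graph_cartesian_product:
  assumes "pair_graph G" "pair_graph H"
  shows "pair_graph (G \<box> H)"
proof -
  interpret G: pair_graph G by fact
  interpret H: pair_graph H by fact
  have sub: "parcs (G \<box> H) \<subseteq> pverts (G \<box> H) \<times> pverts (G \<box> H)"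
    by (auto simp: cartesian_product_def dest: G.wellformed' H.wellformed')
  have fin: "finite (pverts (G \<box> H))"
    by (simp add: cartesian_product_def)
  have symG: "(u, v) \<in> parcs G \<Longrightarrow> (v, u) \<in> parcs G" for u v
    using G.pair_sym_arcs by (auto simp: symmetric_def sym_def)
  have symH: "(u, v) \<in> parcs H \<Longrightarrow> (v, u) \<in> parcs H" for u v
    using H.pair_sym_arcs by (auto simp: symmetric_def sym_def)
  show ?thesis
  proof
    show "fst e \<in> pverts (G \<box> H)" "snd e \<in> pverts (G \<box> H)" if "e \<in> parcs (G \<box> H)" for e
      using sub that by auto
    show "finite (pverts (G \<box> H))" by (rule fin)
    show "finite (parcs (G \<box> H))" using sub fin by (meson finite_SigmaI finite_subset)
    show "fst e \<noteq> snd e" if "e \<in> parcs (G \<box> H)" for e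
      using that by (auto simp: cartesian_product_def dest: G.pair_no_loops H.pair_no_loops)
    show "symmetric (with_proj (G \<box> H))"
      by (auto simp: symmetric_def sym_def cartesian_product_def intro: symG symH)
  qed
qed

lemma localization_number_attained:
  assumes "pair_graph G" "connected (with_proj G)"
  shows "0 < \<zeta> G \<and> (\<exists>\<sigma>. winning_strategy G (\<zeta> G) \<sigma>)"
  unfolding localization_number_def
proof (rule LeastI_ex)
  interpret pair_graph G by fact
  obtain vs where vs: "set vs = pverts G" "distinct vs"
    using finite_distinct_list pair_finite_verts by blast
  have "pverts G \<noteq> {}"
    using assms(2) by (auto simp: connected_def strongly_connected_def mk_symmetric_def)
  then have "0 < length vs"
    using vs by auto
  moreover have "winning_strategy G (length vs) (\<lambda>_. vs)"
    unfolding winning_strategy_def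
  proof (intro conjI allI impI)
    show "cop_strategy G (length vs) (\<lambda>_. vs)"
      using vs by (simp add: cop_strategy_def)
    fix r assume r: "robber_walk G r"
    have "located G (\<lambda>_. vs) r 0"
      unfolding located_def
    proof (intro allI impI)
      fix r' assume *: "robber_walk G r' \<and> answers G (\<lambda>_. vs) r' (Suc 0) = answers G (\<lambda>_. vs) r (Suc 0)"
      then have "gdist G (r' 0) (r 0) = gdist G (r 0) (r 0)"
        using vs r by (auto simp: robber_walk_def)
      then show "r' 0 = r 0"
        using * r assms gdist_eq_0_iff[of G] by (auto simp: robber_walk_def gdist_self)
    qed
    then show "\<exists>t. located G (\<lambda>_. vs) r t" ..
  qed
  ultimately show "\<exists>k>0. \<exists>\<sigma>. winning_strategy G k \<sigma>"
    by blast
qed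

lemma min_doubly_resolving_attained:
  assumes "pair_graph H" "connected (with_proj H)"
  shows "\<exists>W. doubly_resolving_set H W \<and> card W = \<psi> H"
  unfolding min_doubly_resolving_def
proof (rule LeastI_ex)
  have "doubly_resolved H v1 v2 v1 v2" if "v1 \<in> pverts H" "v2 \<in> pverts H" "v1 \<noteq> v2" for v1 v2
  proof -
    have "gdist H v1 v2 \<noteq> 0" "gdist H v2 v1 \<noteq> 0"
      using that gdist_eq_0_iff[OF assms] by auto
    then show ?thesis
      using that by (simp add: doubly_resolved_def gdist_self)
  qed
  then have "doubly_resolving_set H (pverts H)"
    unfolding doubly_resolving_set_def by blast
  then show "\<exists>n W. doubly_resolving_set H W \<and> card W = n"
    by blast
qed

end

(*
  Fix a winning strategy for G and a doubly resolving set W of H with a distinguished element w.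
  When the strategy for G probes b_1, ..., b_k, the Cop probes (b_1,w), ..., (b_k,w) together with
  (b_1,w') for the remaining w' in W. Distances in G \<box> H are sums of distances in the factors,
  so the differences of the answers to the probes (b_1,_) determine the H-coordinate of the Robber.
  Subtracting its distance to w recovers the answers to b_1, ..., b_k for the projection of the
  Robber to G, which is a legal walk because staying is allowed.
*)

theory Submission
  imports Defs
begin

section \<open>Distances in the Cartesian product\<close>

text \<open>Replaces arc lists by relational powers, which compose by \<open>relpow_add\<close>. The
  conjunct \<open>u \<in> pverts G\<close> matters for \<open>n = 0\<close>, where the power is the
  identity on the whole type.\<close>

lemma awalk_iff_relpow:
  "(\<exists>p. pre_digraph.awalk (with_proj G) u p v \<and> length p = n) \<longleftrightarrow>
     u \<in> pverts G \<and> (u, v) \<in> parcs G ^^ n" if "pair_graph G"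
proof -
  interpret pair_graph G by fact
  show ?thesis
  proof (induction n arbitrary: u)
    case 0
    show ?case by (auto simp: awalk_def)
  next
    case (Suc n)
    have "(\<exists>p. awalk u p v \<and> length p = Suc n) \<longleftrightarrow>
        (\<exists>x. (u, x) \<in> parcs G \<and> (\<exists>p. awalk x p v \<and> length p = n))"
    proof
      assume "\<exists>p. awalk u p v \<and> length p = Suc n"
      then obtain e p where "awalk u (e # p) v" "length p = n"
        by (metis length_Suc_conv)
      then show "\<exists>x. (u, x) \<in> parcs G \<and> (\<exists>p. awalk x p v \<and> length p = n)"
        by (cases e) (auto simp: awalk_Cons_iff)
    next
      assume "\<exists>x. (u, x) \<in> parcs G \<and> (\<exists>p. awalk x p v \<and> length p = n)"
      then obtain x p where "(u, x) \<in> parcs G" "awalk x p v" "length p = n"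
        by blast
      then have "awalk u ((u, x) # p) v \<and> length ((u, x) # p) = Suc n"
        by (auto simp: awalk_Cons_iff)
      then show "\<exists>p. awalk u p v \<and> length p = Suc n" by blast
    qed
    also have "\<dots> \<longleftrightarrow> u \<in> pverts G \<and> (u, v) \<in> parcs G ^^ Suc n"
      \<comment> \<open>Both ends of an arc are vertices, so the condition on \<open>x\<close> from
        the induction hypothesis holds automatically.\<close>
      unfolding Suc.IH using relpow_Suc_I2 relpow_Suc_D2 by (metis wellformed'(1,2))
    finally show ?case .
  qed
qed

lemma gdist_eq_Least_relpow:
  assumes "pair_graph G" "u \<in> pverts G"
  shows "gdist G u v = (LEAST n. (u, v) \<in> parcs G ^^ n)"
  using assms by (simp add: gdist_def awalk_iff_relpow)

lemma gdist_le:
  assumes "pair_graph G" "u \<in> pverts G" "(u, v) \<in> parcs G ^^ n"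
  shows "gdist G u v \<le> n"
  using assms by (simp add: gdist_eq_Least_relpow Least_le)

lemma relpow_gdist:
  assumes "pair_graph G" "connected (with_proj G)" "u \<in> pverts G" "v \<in> pverts G"
  shows "(u, v) \<in> parcs G ^^ gdist G u v"
proof -
  interpret pair_graph G by fact
  have "strongly_connected (with_proj G)"
    using assms(2) symmetric_connected_imp_strongly_connected[OF sym_arcs] by simp
  then have "u \<rightarrow>\<^sup>*\<^bsub>with_proj G\<^esub> v"
    using assms(3,4) by (simp add: strongly_connected_def)
  then have "\<exists>n. (u, v) \<in> parcs G ^^ n"
    using awalk_iff_relpow[OF assms(1)] by (metis reachable_awalk)
  then show ?thesis
    unfolding gdist_eq_Least_relpow[OF assms(1,3)] by (rule LeastI_ex)
qed

lemma relpow_cartesian_product_fst: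
  assumes "(u, v) \<in> parcs G ^^ n" "x \<in> pverts H"
  shows "((u, x), (v, x)) \<in> parcs (G \<box> H) ^^ n"
  using assms(1)
proof (induction n arbitrary: v)
  case (Suc n)
  then obtain y where "(u, y) \<in> parcs G ^^ n" "(y, v) \<in> parcs G" by auto
  moreover from this have "((y, x), (v, x)) \<in> parcs (G \<box> H)"
    using assms(2) by (simp add: cartesian_product_def)
  ultimately show ?case using Suc.IH by auto
qed auto

lemma relpow_cartesian_product_snd:
  assumes "(x, y) \<in> parcs H ^^ n" "u \<in> pverts G"
  shows "((u, x), (u, y)) \<in> parcs (G \<box> H) ^^ n"
  using assms(1)
proof (induction n arbitrary: y)
  case (Suc n)
  then obtain z where "(x, z) \<in> parcs H ^^ n" "(z, y) \<in> parcs H" by auto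
  moreover from this have "((u, z), (u, y)) \<in> parcs (G \<box> H)"
    using assms(2) by (simp add: cartesian_product_def)
  ultimately show ?case using Suc.IH by auto
qed auto

text \<open>Each arc of the product moves exactly one coordinate; \<open>i\<close> and
  \<open>j\<close> count the moves of the two kinds.\<close>

lemma relpow_cartesian_product_split:
  assumes "(p, q) \<in> parcs (G \<box> H) ^^ n"
  shows "\<exists>i j. n = i + j \<and> (fst p, fst q) \<in> parcs G ^^ i \<and> (snd p, snd q) \<in> parcs H ^^ j"
  using assms
proof (induction n arbitrary: q)
  case 0
  then show ?case by auto
next
  case (Suc n)
  then obtain s where s: "(p, s) \<in> parcs (G \<box> H) ^^ n" "(s, q) \<in> parcs (G \<box> H)" by auto
  then obtain i j where ij: "n = i + j" "(fst p, fst s) \<in> parcs G ^^ i" "(snd p, snd s) \<in> parcs H ^^ j"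
    using Suc.IH by blast
  from s(2) consider "fst s = fst q" "(snd s, snd q) \<in> parcs H"
    | "snd s = snd q" "(fst s, fst q) \<in> parcs G"
    by (auto simp: cartesian_product_def)
  then show ?case
  proof cases
    case 1
    then show ?thesis using ij by (intro exI[of _ i] exI[of _ "Suc j"]) auto
  next
    case 2
    then show ?thesis using ij by (intro exI[of _ "Suc i"] exI[of _ j]) auto
  qed
qed

text \<open>Upper bound: walk in the layer over \<open>x\<close> to \<open>v\<close>, then inside
  the copy of H at \<open>v\<close>. Lower bound: a shortest walk in the product splits into walks
  in the two factors.\<close>

lemma gdist_cartesian_product:
  assumes G: "pair_graph G" "connected (with_proj G)"
    and H: "pair_graph H" "connected (with_proj H)"
    and "u \<in> pverts G" "v \<in> pverts G" "x \<in> pverts H" "y \<in> pverts H"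
  shows "gdist (G \<box> H) (u, x) (v, y) = gdist G u v + gdist H x y"
proof -
  have P: "pair_graph (G \<box> H)" "(u, x) \<in> pverts (G \<box> H)"
    using pair_graph_cartesian_product[OF G(1) H(1)] assms(5,7)
    by (auto simp: cartesian_product_def)
  have path: "((u, x), (v, y)) \<in> parcs (G \<box> H) ^^ (gdist G u v + gdist H x y)"
    unfolding relpow_add
    using relpow_cartesian_product_fst[OF relpow_gdist[OF G \<open>u \<in> _\<close> \<open>v \<in> _\<close>] \<open>x \<in> _\<close>]
      relpow_cartesian_product_snd[OF relpow_gdist[OF H \<open>x \<in> _\<close> \<open>y \<in> _\<close>] \<open>v \<in> _\<close>]
    by blast
  \<comment> \<open>The walk \<open>path\<close> shows that some length occurs, so the least one is
    attained.\<close>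
  have "((u, x), (v, y)) \<in> parcs (G \<box> H) ^^ gdist (G \<box> H) (u, x) (v, y)"
    unfolding gdist_eq_Least_relpow[OF P] using path by (rule LeastI)
  then obtain i j where "gdist (G \<box> H) (u, x) (v, y) = i + j"
    "(u, v) \<in> parcs G ^^ i" "(x, y) \<in> parcs H ^^ j"
    using relpow_cartesian_product_split by fastforce
  then have "gdist G u v + gdist H x y \<le> gdist (G \<box> H) (u, x) (v, y)"
    using gdist_le G(1) H(1) assms(5,7) by (metis add_mono)
  with gdist_le[OF P path] show ?thesis by simp
qed

section \<open>Lifting a strategy\<close>

text \<open>The list \<open>w # ws\<close> enumerates W. The probe \<open>(hd bs, w)\<close> serves
  both the copy of \<open>bs\<close> and the copy of W, which saves one cop.\<close>

definition lift_probe :: "'b \<Rightarrow> 'b list \<Rightarrow> 'a list \<Rightarrow> ('a \<times> 'b) list" where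
  "lift_probe w ws bs = map (\<lambda>b. (b, w)) bs @ map (Pair (hd bs)) ws"

text \<open>Models the answer to a lifted probe when the Robber's projection to G would answer
  \<open>xs\<close> and \<open>y\<close> is its H-coordinate.\<close>

definition lift_answer ::
  "'b pair_pre_digraph \<Rightarrow> 'b \<Rightarrow> 'b list \<Rightarrow> nat list \<times> 'b \<Rightarrow> nat list" where
  "lift_answer H w ws = (\<lambda>(xs, y).
     map (\<lambda>a. a + gdist H y w) xs @ map (\<lambda>w'. hd xs + gdist H y w') ws)"

text \<open>A decoder for lifted answers. Fixing the length \<open>k\<close> makes the inverse
  unique; on vectors that are no lifted answer the value is arbitrary.\<close>

definition project_answer ::
  "'b pair_pre_digraph \<Rightarrow> 'b \<Rightarrow> 'b list \<Rightarrow> nat \<Rightarrow> nat list \<Rightarrow> nat list" where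
  "project_answer H w ws k v =
     fst (inv_into ({xs. length xs = k} \<times> pverts H) (lift_answer H w ws) v)"

text \<open>If two lifted answers agree, the entries belonging to the first probe force the
  difference of the distances from \<open>y\<close> and \<open>z\<close> to be constant on W. Double
  resolution then gives \<open>y = z\<close>, and cancelling the common shift gives
  \<open>xs = ys\<close>.\<close>

lemma inj_on_lift_answer:
  assumes "doubly_resolving_set H (set (w # ws))" "0 < k"
  shows "inj_on (lift_answer H w ws) ({xs. length xs = k} \<times> pverts H)"
proof (rule inj_onI, clarify)
  fix xs ys :: "nat list" and y z
  assume *: "k = length xs" "length ys = length xs" "y \<in> pverts H" "z \<in> pverts H"
    and eq: "lift_answer H w ws (xs, y) = lift_answer H w ws (ys, z)"
  from eq * have eq_w: "map (\<lambda>a. a + gdist H y w) xs = map (\<lambda>a. a + gdist H z w) ys"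
    and eq_ws: "map (\<lambda>w'. hd xs + gdist H y w') ws = map (\<lambda>w'. hd ys + gdist H z w') ws"
    by (auto simp: lift_answer_def)
  have "xs \<noteq> []" "ys \<noteq> []"
    using * assms(2) by auto
  then have "hd xs + gdist H y w = hd ys + gdist H z w"
    using arg_cong[OF eq_w, of hd] by (simp add: hd_map)
  \<comment> \<open>The case of \<open>w\<close> is the head of the first block, which exists
    because \<open>0 < k\<close>; the other cases are the second block.\<close>
  with eq_ws have hd: "hd xs + gdist H y w' = hd ys + gdist H z w'" if "w' \<in> set (w # ws)" for w'
    using that by auto
  \<comment> \<open>The right-hand side does not depend on \<open>u\<close>, so no two elements of W
    doubly resolve \<open>y\<close> and \<open>z\<close>.\<close>
  have diff: "int (gdist H y u) - int (gdist H z u) = int (hd ys) - int (hd xs)"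
    if "u \<in> set (w # ws)" for u
    using hd[OF that] by linarith
  have "y = z"
  proof (rule ccontr)
    assume "y \<noteq> z"
    then obtain u1 u2 where "u1 \<in> set (w # ws)" "u2 \<in> set (w # ws)" "doubly_resolved H y z u1 u2"
      using assms(1) * unfolding doubly_resolving_set_def by blast
    then show False
      using diff by (simp only: doubly_resolved_def)
  qed
  moreover have "inj (\<lambda>a. a + gdist H y w)" by (simp add: inj_def)
  ultimately show "xs = ys \<and> y = z"
    using eq_w by (simp add: inj_map_eq_map)
qed

lemma project_lift_answer:
  assumes "doubly_resolving_set H (set (w # ws))" "0 < length xs" "y \<in> pverts H"
  shows "project_answer H w ws (length xs) (lift_answer H w ws (xs, y)) = xs"
  using inv_into_f_f[OF inj_on_lift_answer[OF assms(1,2)], of "(xs, y)"] assms(3)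
  by (simp add: project_answer_def)

text \<open>Additivity of distances, applied entry by entry. Nonemptiness of \<open>bs\<close> makes
  \<open>hd bs\<close> a vertex and lets \<open>hd\<close> commute with \<open>map\<close>.\<close>

lemma answer_lift_probe:
  assumes "pair_graph G" "connected (with_proj G)" "pair_graph H" "connected (with_proj H)"
    and "p \<in> pverts (G \<box> H)" "set bs \<subseteq> pverts G" "bs \<noteq> []" "set (w # ws) \<subseteq> pverts H"
  shows "map (gdist (G \<box> H) p) (lift_probe w ws bs) =
    lift_answer H w ws (map (gdist G (fst p)) bs, snd p)"
proof -
  have "fst p \<in> pverts G" "snd p \<in> pverts H" "hd bs \<in> pverts G"
    using assms(5-7) by (auto simp: cartesian_product_def)
  then have d: "gdist (G \<box> H) p (b, y) = gdist G (fst p) b + gdist H (snd p) y"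
    if "b \<in> pverts G" "y \<in> pverts H" for b y
    using gdist_cartesian_product[OF assms(1-4), of "fst p" b "snd p" y] that by simp
  show ?thesis
    using assms(6-8) \<open>hd bs \<in> _\<close>
    by (auto simp: lift_probe_def lift_answer_def hd_map subset_iff intro!: d)
qed

lemma robber_walk_in_pverts:
  assumes "pair_graph G" "robber_walk G r"
  shows "r t \<in> pverts G"
proof -
  interpret pair_graph G by fact
  show ?thesis
  proof (induction t)
    case (Suc t)
    then show ?case
      using assms(2) wellformed'(2)[of "r t" "r (Suc t)"] by (metis robber_walk_def)
  qed (use assms(2) in \<open>simp add: robber_walk_def\<close>)
qed

lemma robber_walk_fst:
  assumes "robber_walk (G \<box> H) r"
  shows "robber_walk G (fst \<circ> r)"
  unfolding robber_walk_def
proof (intro conjI allI)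
  show "(fst \<circ> r) 0 \<in> pverts G"
    using assms by (auto simp: robber_walk_def cartesian_product_def)
  fix t
  have "r (Suc t) = r t \<or> (r t, r (Suc t)) \<in> parcs (G \<box> H)"
    using assms by (simp add: robber_walk_def)
  then show "(fst \<circ> r) (Suc t) = (fst \<circ> r) t \<or> ((fst \<circ> r) t, (fst \<circ> r) (Suc t)) \<in> parcs G"
    by (auto simp: cartesian_product_def)
qed

text \<open>The lifted strategy decodes its history and feeds it to \<open>\<sigma>\<close>, so a
  play on the product shadows a play of \<open>\<sigma>\<close> against the projected walk and
  locates the Robber in the same turn.\<close>

lemma winning_strategy_lift:
  assumes G: "pair_graph G" "connected (with_proj G)"
    and H: "pair_graph H" "connected (with_proj H)"
    and \<sigma>: "winning_strategy G k \<sigma>" "0 < k"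
    and W: "doubly_resolving_set H (set (w # ws))" "distinct (w # ws)"
  shows "winning_strategy (G \<box> H) (k + length ws)
    (\<lambda>h. lift_probe w ws (\<sigma> (map (project_answer H w ws k) h)))"
    (is "winning_strategy ?P _ ?\<tau>")
proof -
  have sub: "set (w # ws) \<subseteq> pverts H"
    using W(1) by (simp add: doubly_resolving_set_def)
  have \<sigma>_probe: "length (\<sigma> h) = k" "distinct (\<sigma> h)" "set (\<sigma> h) \<subseteq> pverts G" "\<sigma> h \<noteq> []" for h
    using \<sigma> by (auto simp: winning_strategy_def cop_strategy_def)
  have hd_in: "hd (\<sigma> h) \<in> pverts G" for h
    using \<sigma>_probe(3,4) hd_in_set by blast
  have cop: "cop_strategy ?P (k + length ws) ?\<tau>"
    unfolding cop_strategy_def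
  proof (intro allI conjI)
    fix h
    show "length (?\<tau> h) = k + length ws"
      using \<sigma>_probe by (simp add: lift_probe_def)
    \<comment> \<open>The two blocks are disjoint because \<open>w\<close> does not occur in
      \<open>ws\<close>.\<close>
    show "distinct (?\<tau> h)"
      using \<sigma>_probe W(2) by (auto simp: lift_probe_def distinct_map inj_on_def)
    show "set (?\<tau> h) \<subseteq> pverts ?P"
      using \<sigma>_probe(3) hd_in sub
      by (fastforce simp: lift_probe_def cartesian_product_def)
  qed
  have ans: "map (gdist ?P (r t)) (?\<tau> h) = lift_answer H w ws
      (map (gdist G (fst (r t))) (\<sigma> (map (project_answer H w ws k) h)), snd (r t))"
    and snd_in: "snd (r t) \<in> pverts H"
    if "robber_walk ?P r" for r t h
  proof -
    have "r t \<in> pverts ?P"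
      using that G(1) H(1) by (simp add: robber_walk_in_pverts pair_graph_cartesian_product)
    then show "map (gdist ?P (r t)) (?\<tau> h) = lift_answer H w ws
        (map (gdist G (fst (r t))) (\<sigma> (map (project_answer H w ws k) h)), snd (r t))"
      "snd (r t) \<in> pverts H"
      using answer_lift_probe[OF G H _ \<sigma>_probe(3,4) sub]
      by (auto simp: cartesian_product_def)
  qed
  \<comment> \<open>The invariant of the simulation: the decoded history is the one that
    \<open>\<sigma>\<close> sees against the projection.\<close>
  have proj: "map (project_answer H w ws k) (answers ?P ?\<tau> r t) = answers G \<sigma> (fst \<circ> r) t"
    if r: "robber_walk ?P r" for r t
  proof (induction t)
    case (Suc t)
    have "project_answer H w ws k
        (lift_answer H w ws (map (gdist G (fst (r t))) (\<sigma> h), snd (r t))) =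
        map (gdist G (fst (r t))) (\<sigma> h)" for h
      using project_lift_answer[OF W(1), of "map (gdist G (fst (r t))) (\<sigma> h)" "snd (r t)"]
        \<sigma>(2) \<sigma>_probe(1) snd_in[OF r] by simp
    then show ?case
      using Suc.IH ans[OF r, of t "answers ?P ?\<tau> r t"] by simp
  qed simp
  have "located ?P ?\<tau> r t" if r: "robber_walk ?P r" and loc: "located G \<sigma> (fst \<circ> r) t" for r t
    unfolding located_def
  proof (intro allI impI, elim conjE)
    fix r'
    assume r': "robber_walk ?P r'" and eq: "answers ?P ?\<tau> r' (Suc t) = answers ?P ?\<tau> r (Suc t)"
    have "answers G \<sigma> (fst \<circ> r') (Suc t) = answers G \<sigma> (fst \<circ> r) (Suc t)"
      using proj[OF r, of "Suc t"] proj[OF r', of "Suc t"] eq by metis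
    then have fst_eq: "fst (r' t) = fst (r t)"
      using loc robber_walk_fst[OF r'] by (auto simp: located_def)
    \<comment> \<open>Equal histories lead to the same probe in turn \<open>t\<close>, so the two
      answers of that turn can be compared; injectivity then yields the H-coordinate.\<close>
    let ?h = "answers ?P ?\<tau> r t"
    have "map (gdist ?P (r' t)) (?\<tau> ?h) = map (gdist ?P (r t)) (?\<tau> ?h)"
      using eq by auto
    then have "snd (r' t) = snd (r t)"
      using ans[OF r, of t ?h] ans[OF r', of t ?h]
        inj_onD[OF inj_on_lift_answer[OF W(1) \<sigma>(2)]] snd_in[OF r] snd_in[OF r'] \<sigma>_probe(1)
      by fastforce
    with fst_eq show "r' t = r t" by (simp add: prod_eq_iff)
  qed
  then show ?thesis
    using cop \<sigma>(1) robber_walk_fst unfolding winning_strategy_def by blast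
qed

theorem theorem4p6:
  fixes G :: "'a pair_pre_digraph" and H :: "'b pair_pre_digraph"
  assumes "pair_graph G" and "connected (with_proj G)"
    and "pair_graph H" and "connected (with_proj H)"
    and "card (pverts H) \<ge> 2"
  shows "\<zeta> (G \<box> H) \<le> \<zeta> G + \<psi> H - 1"
proof -
  obtain \<sigma> where \<sigma>: "0 < \<zeta> G" "winning_strategy G (\<zeta> G) \<sigma>"
    using localization_number_attained[OF assms(1,2)] by blast
  obtain W where W: "doubly_resolving_set H W" "card W = \<psi> H"
    using min_doubly_resolving_attained[OF assms(3,4)] by blast
  have "finite (pverts H)"
    using assms(5) card.infinite by fastforce
  then have "finite W"
    using W(1) finite_subset by (auto simp: doubly_resolving_set_def)
  \<comment> \<open>Two distinct vertices have to be resolved, so W has an element to serve as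
    \<open>w\<close>.\<close>
  obtain v1 v2 where "v1 \<in> pverts H" "v2 \<in> pverts H" "v1 \<noteq> v2"
    using assms(5) by (auto simp: numeral_2_eq_2 card_le_Suc_iff)
  then have "W \<noteq> {}"
    using W(1) by (auto simp: doubly_resolving_set_def)
  then obtain w ws where ws: "set (w # ws) = W" "distinct (w # ws)"
    using finite_distinct_list[OF \<open>finite W\<close>] by (metis list.exhaust set_empty)
  then have "length (w # ws) = \<psi> H"
    using W(2) distinct_card by metis
  \<comment> \<open>The subtraction on naturals is exact, since \<open>\<psi> H\<close> is the
    length of the nonempty list \<open>w # ws\<close>.\<close>
  then have "\<zeta> G + length ws = \<zeta> G + \<psi> H - 1" by simp
  moreover have "\<exists>\<tau>. winning_strategy (G \<box> H) (\<zeta> G + length ws) \<tau>"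
    using winning_strategy_lift[OF assms(1-4) \<sigma>(2,1)] ws W(1) by blast
  ultimately show ?thesis
    using \<sigma>(1) unfolding localization_number_def[of "G \<box> H"] by (intro Least_le) auto
qed

end
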